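(* Let $X=(X_k)_{k\in\mathbb{N}}$ be a sequence of independent Bernoulli random variables with $\mathbb{P}[X_k=1]=1-\mathbb{P}[X_k=0]=p_k\in[0,1]$ for $k\in\mathbb{N}$. Assume that $\sum_k p_k=\infty$ and $\sum_k p_k^2<\infty$. Let $\mathcal{E}_X=\{k\in\mathbb{N}:X_k=1\}$. Then almost surely $\mathcal{E}_X$ does not have bounded gap. That is, if we write $\mathcal{E}_X$ as an increasing sequence $\mathcal{E}_X=\{n_1(X)<n_2(X)<\cdots\}$, then $$\lim_{k\to\infty}\bigl(n_{k+1}(X)-n_k(X)\bigr)=\infty\quad\text{almost surely}.$$
   Context: $\mathbb{N}=\{1,2,\dots\}$. By the Borel-Cantelli lemma, $\sum_k p_k=\infty$ is equivalent to $\mathcal{E}_X$ being almost surely infinite, so the increasing enumeration $\{n_k(X)\}_{k\in\mathbb{N}}$ is almost surely well defined. For an infinite subset $S=\{n_1<n_2<\cdots\}\subset\mathbb{N}$, the gap of $S$ is $\mathrm{Gap}(S)=\sup_{k\in\mathbb{N}}(n_{k+1}-n_k)$, and $S$ has bounded gap if $\mathrm{Gap}(S)<\infty$. *)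

theory Defs
  imports "HOL-Probability.Probability"
begin

text \<open>
  The natural numbers of the mathematical text start at 1, so random variables \<open>X k\<close> matter
  only for \<open>k \<ge> 1\<close>.
\<close>

definition success_set :: "(nat \<Rightarrow> 'a \<Rightarrow> real) \<Rightarrow> 'a \<Rightarrow> nat set" where
  "success_set X \<omega> = {k. 1 \<le> k \<and> X k \<omega> = 1}"

text \<open>
  For infinite \<open>S = {n\<^sub>1 < n\<^sub>2 < \<dots>}\<close>, the library function \<open>enumerate\<close> counts from 0, that is,
  \<open>enumerate S k\<close> is the element \<open>n\<close> of index \<open>k + 1\<close>. The two definitions below are meaningful
  only for infinite \<open>S\<close>; the differences are then positive, so truncated subtraction is harmless.
\<close>

definition gap :: "nat set \<Rightarrow> enat" where
  "gap S = (SUP k. enat (enumerate S (Suc k) - enumerate S k))"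

definition bounded_gap :: "nat set \<Rightarrow> bool" where
  "bounded_gap S \<longleftrightarrow> gap S < \<infinity>"

end

theory Submission
  imports Defs
begin

text \<open>
  The second Borel--Cantelli lemma and \<open>\<Sum> p\<^sub>k = \<infinity>\<close> make the success set almost surely infinite.
  For a fixed distance \<open>d \<ge> 1\<close>, independence gives
  \<open>P (X\<^sub>k = X\<^bsub>k+d\<^esub> = 1) = p\<^sub>k p\<^bsub>k+d\<^esub> \<le> (p\<^sub>k\<^sup>2 + p\<^bsub>k+d\<^esub>\<^sup>2) / 2\<close>, which is summable in \<open>k\<close>, so by the first
  Borel--Cantelli lemma only finitely many pairs of successes are at distance \<open>d\<close>. Almost surely
  this holds for all of the countably many \<open>d\<close> at once; then every value \<open>d\<close> occurs
  only finitely often among the gaps, that is, the gaps tend to infinity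
  (\<open>filterlim_enumerate_gaps\<close>). In particular they are unbounded.
\<close>

lemma (in prob_space) indep_vars_reindex:
  assumes indep: "indep_vars N X I" and inj: "inj_on f J" and im: "f ` J \<subseteq> I"
  shows "indep_vars (\<lambda>j. N (f j)) (\<lambda>j. X (f j)) J"
  unfolding indep_vars_def2
proof (intro conjI ballI)
  show "random_variable (N (f j)) (X (f j))" if "j \<in> J" for j
    using indep im that by (auto simp: indep_vars_def2)
next
  let ?F = "\<lambda>i. {X i -` A \<inter> space M |A. A \<in> sets (N i)}"
  have F: "indep_sets ?F I"
    using indep by (simp add: indep_vars_def2)
  show "indep_sets (\<lambda>j. ?F (f j)) J"
  proof (rule indep_setsI)
    show "?F (f j) \<subseteq> events" if "j \<in> J" for j
      using F im that by (auto simp: indep_sets_def)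
  next
    fix A K
    assume K: "K \<noteq> {}" "K \<subseteq> J" "finite K" and A: "\<forall>j\<in>K. A j \<in> ?F (f j)"
    have inj_K: "inj_on f K"
      using inj K(2) by (rule inj_on_subset)
    define A' where "A' i = A (the_inv_into K f i)" for i
    have A': "A' (f j) = A j" if "j \<in> K" for j
      using that by (simp add: A'_def the_inv_into_f_f[OF inj_K])
    have "prob (\<Inter>j\<in>K. A j) = prob (\<Inter>i\<in>f ` K. A' i)"
      using A' by simp
    also have "\<dots> = (\<Prod>i\<in>f ` K. prob (A' i))"
    proof (rule indep_setsD[OF F])
      show "f ` K \<subseteq> I" using im K(2) by blast
      show "\<forall>i\<in>f ` K. A' i \<in> ?F i"
      proof
        fix i assume "i \<in> f ` K"
        then obtain j where "j \<in> K" "i = f j" by blast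
        then show "A' i \<in> ?F i"
          using A A' by simp
      qed
    qed (use K in auto)
    also have "\<dots> = (\<Prod>j\<in>K. prob (A j))"
      using A' by (simp add: prod.reindex[OF inj_K])
    finally show "prob (\<Inter>j\<in>K. A j) = (\<Prod>j\<in>K. prob (A j))" .
  qed
qed

text \<open>
  The second Borel--Cantelli lemma, for the events \<open>Y\<^sub>n \<in> B\<^sub>n\<close>. With \<open>q\<^sub>n\<close> their probabilities, the
  probability that none of the events with index \<open>m \<le> n < K\<close> occurs is
  \<open>\<Prod> (1 - q\<^sub>n) \<le> exp (- \<Sum> q\<^sub>n)\<close>, which tends to \<open>0\<close> as \<open>K\<close> grows.
\<close>

lemma (in prob_space) AE_infinite_indep_vars:
  fixes Y :: "nat \<Rightarrow> 'a \<Rightarrow> 'b"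
  assumes indep: "indep_vars N Y UNIV"
    and B: "\<And>n. B n \<in> sets (N n)"
    and div: "\<not> summable (\<lambda>n. \<P>(\<omega> in M. Y n \<omega> \<in> B n))"
  shows "AE \<omega> in M. infinite {n. Y n \<omega> \<in> B n}"
proof -
  define q where "q n = \<P>(\<omega> in M. Y n \<omega> \<in> B n)" for n
  have rv: "Y n \<in> measurable M (N n)" for n
    using indep by (auto simp: indep_vars_def2)
  have meas: "Measurable.pred M (\<lambda>\<omega>. Y n \<omega> \<in> B n)" for n
    using measurable_sets[OF rv B] by (simp add: pred_def vimage_def Int_def conj_commute)
  have q_nonneg: "0 \<le> q n" for n
    by (simp add: q_def)
  have sum_at_top: "\<exists>N\<ge>m. C < (\<Sum>n\<in>{m..<N}. q n)" for m C
  proof (rule ccontr)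
    assume *: "\<not> ?thesis"
    have "(\<Sum>n<k. q n) \<le> (\<Sum>n<m. q n) + \<bar>C\<bar>" for k
    proof (cases "m \<le> k")
      case True
      then have "(\<Sum>n<k. q n) = (\<Sum>n<m. q n) + (\<Sum>n\<in>{m..<k}. q n)"
        by (metis atLeast0LessThan sum.atLeastLessThan_concat zero_le)
      also have "\<dots> \<le> (\<Sum>n<m. q n) + \<bar>C\<bar>"
        using * True by (auto simp: not_less intro: order_trans)
      finally show ?thesis .
    next
      case False
      then have "(\<Sum>n<k. q n) \<le> (\<Sum>n<m. q n)"
        by (intro sum_mono2) (auto simp: q_nonneg)
      then show ?thesis by simp
    qed
    then have "summable q"
      by (intro bounded_imp_summable)
         (auto simp: q_nonneg simp flip: lessThan_Suc_atMost simp del: sum.lessThan_Suc)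
    with div show False by (simp add: q_def[abs_def])
  qed
  have "AE \<omega> in M. \<exists>n\<ge>m. Y n \<omega> \<in> B n" for m
  proof -
    define D where "D = {\<omega> \<in> space M. \<forall>n\<ge>m. Y n \<omega> \<notin> B n}"
    have D: "D \<in> events"
      unfolding D_def using meas by measurable
    have bound: "prob D \<le> exp (- (\<Sum>n\<in>{m..<K}. q n))" if "m < K" for K
    proof -
      have "prob D \<le> prob (\<Inter>n\<in>{m..<K}. Y n -` (space (N n) - B n) \<inter> space M)"
        using rv that B
        by (intro finite_measure_mono sets.finite_INT)
           (auto simp: D_def intro!: measurable_sets[OF rv] measurable_space[OF rv])
      also have "\<dots> = (\<Prod>n\<in>{m..<K}. prob (Y n -` (space (N n) - B n) \<inter> space M))"
        using that B by (intro indep_varsD[OF indep]) auto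
      also have "\<dots> = (\<Prod>n\<in>{m..<K}. 1 - q n)"
      proof (rule prod.cong)
        fix n
        have "Y n -` (space (N n) - B n) \<inter> space M
            = space M - {\<omega> \<in> space M. Y n \<omega> \<in> B n}"
          using measurable_space[OF rv] by auto
        then show "prob (Y n -` (space (N n) - B n) \<inter> space M) = 1 - q n"
          using meas[of n] by (simp add: q_def prob_compl pred_def)
      qed simp
      also have "\<dots> \<le> (\<Prod>n\<in>{m..<K}. exp (- q n))"
        by (intro prod_mono) (use exp_minus_ge in \<open>auto simp: q_def\<close>)
      also have "\<dots> = exp (- (\<Sum>n\<in>{m..<K}. q n))"
        by (simp add: exp_sum sum_negf[symmetric])
      finally show ?thesis .
    qed
    have "prob D \<le> e" if "e > 0" for e
    proof -
      obtain K where K: "K \<ge> m" "max 0 (- ln e) < (\<Sum>n\<in>{m..<K}. q n)"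
        using sum_at_top by blast
      then have "m < K"
        by (cases "m = K") auto
      then have "prob D \<le> exp (- (\<Sum>n\<in>{m..<K}. q n))"
        by (rule bound)
      also have "\<dots> \<le> exp (ln e)"
        using K(2) by (subst exp_le_cancel_iff) simp
      finally show ?thesis using that by simp
    qed
    then have "prob D = 0"
      by (metis field_le_epsilon add_0 measure_nonneg order_antisym)
    then have "AE \<omega> in M. \<omega> \<notin> D"
      using D by (simp add: prob_eq_0)
    then show ?thesis
      by (rule AE_mp) (auto simp: D_def intro!: AE_I2)
  qed
  then have "AE \<omega> in M. \<forall>m. \<exists>n\<ge>m. Y n \<omega> \<in> B n"
    by (subst AE_all_countable) blast
  then show ?thesis
    by (simp add: infinite_nat_iff_unbounded_le)
qed

lemma filterlim_enumerate_gaps: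
  fixes S :: "nat set"
  assumes S: "infinite S"
    and sparse: "\<And>d. d \<ge> 1 \<Longrightarrow> \<forall>\<^sub>F n in sequentially. \<not> (n \<in> S \<and> n + d \<in> S)"
  shows "filterlim (\<lambda>k. real (enumerate S (Suc k)) - real (enumerate S k)) at_top sequentially"
  unfolding filterlim_at_top_dense
proof
  fix C :: real
  have "\<forall>\<^sub>F n in sequentially. \<forall>d\<in>{1..nat \<lceil>C\<rceil>}. \<not> (n \<in> S \<and> n + d \<in> S)"
    by (intro eventually_ball_finite) (use sparse in auto)
  then obtain n0 where n0: "\<And>n d. n \<ge> n0 \<Longrightarrow> 1 \<le> d \<Longrightarrow> d \<le> nat \<lceil>C\<rceil> \<Longrightarrow> \<not> (n \<in> S \<and> n + d \<in> S)"
    unfolding eventually_sequentially by (metis atLeastAtMost_iff)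
  have "C < real (enumerate S (Suc k)) - real (enumerate S k)" if "k \<ge> n0" for k
  proof -
    define d where "d = enumerate S (Suc k) - enumerate S k"
    have less: "enumerate S k < enumerate S (Suc k)"
      using S by (rule enumerate_step)
    then have d: "enumerate S (Suc k) = enumerate S k + d" "d \<ge> 1"
      by (auto simp: d_def)
    have "n0 \<le> enumerate S k"
      using le_enumerate[OF S, of k] that by simp
    moreover have "enumerate S k \<in> S" "enumerate S k + d \<in> S"
      using enumerate_in_set[OF S] d(1) by metis+
    ultimately have "nat \<lceil>C\<rceil> < d"
      using n0[of "enumerate S k" d] d(2) by linarith
    then have "C < real d" by linarith
    then show ?thesis using d(1) by simp
  qed
  then show "\<forall>\<^sub>F k in sequentially. C < real (enumerate S (Suc k)) - real (enumerate S k)"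
    unfolding eventually_sequentially by blast
qed

lemma not_bounded_gap_if_gaps_at_top:
  assumes "filterlim (\<lambda>k. real (enumerate S (Suc k)) - real (enumerate S k)) at_top sequentially"
  shows "\<not> bounded_gap S"
proof
  assume "bounded_gap S"
  then obtain b where b: "gap S = enat b"
    by (auto simp: bounded_gap_def)
  have "\<forall>\<^sub>F k in sequentially. real b < real (enumerate S (Suc k)) - real (enumerate S k)"
    using assms by (simp add: filterlim_at_top_dense)
  then obtain k where k: "real b < real (enumerate S (Suc k)) - real (enumerate S k)"
    by (auto simp: eventually_sequentially)
  have "enat (enumerate S (Suc k) - enumerate S k) \<le> gap S"
    unfolding gap_def by (rule SUP_upper) simp
  with b k show False by simp
qed

lemma (in prob_space) AE_eventually_not_both_successes:
  fixes X :: "nat \<Rightarrow> 'a \<Rightarrow> 'b"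
  assumes indep: "indep_vars N X UNIV"
    and B: "\<And>n. B n \<in> sets (N n)"
    and sq: "summable (\<lambda>n. (\<P>(\<omega> in M. X n \<omega> \<in> B n))\<^sup>2)"
    and d: "d \<ge> 1"
  shows "AE \<omega> in M. \<forall>\<^sub>F n in sequentially. \<not> (X n \<omega> \<in> B n \<and> X (n + d) \<omega> \<in> B (n + d))"
proof -
  define q where "q n = \<P>(\<omega> in M. X n \<omega> \<in> B n)" for n
  define E where "E n = (\<Inter>k\<in>{n, n + d}. X k -` B k \<inter> space M)" for n
  have rv: "X n \<in> measurable M (N n)" for n
    using indep by (auto simp: indep_vars_def2)
  have E: "E n \<in> events" for n
    unfolding E_def using measurable_sets[OF rv B] by (intro sets.finite_INT) auto
  have prob_q: "prob (X n -` B n \<inter> space M) = q n" for n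
    by (simp add: q_def vimage_def Int_def conj_commute)
  have prob_E: "prob (E n) = q n * q (n + d)" for n
  proof -
    have "prob (E n) = (\<Prod>k\<in>{n, n + d}. prob (X k -` B k \<inter> space M))"
      unfolding E_def using B by (intro indep_varsD[OF indep]) auto
    then show ?thesis using d by (simp add: prob_q)
  qed
  have "summable (\<lambda>n. (q n)\<^sup>2 + (q (n + d))\<^sup>2)"
    using sq by (intro summable_add) (simp_all add: q_def summable_iff_shift[where f = "\<lambda>n. (q n)\<^sup>2"] flip: q_def)
  then have "summable (\<lambda>n. prob (E n))"
  proof (rule summable_comparison_test'[where N = 0])
    fix n
    have "2 * (q n * q (n + d)) \<le> (q n)\<^sup>2 + (q (n + d))\<^sup>2"
      using sum_squares_bound[of "q n" "q (n + d)"] by simp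
    moreover have "0 \<le> q n * q (n + d)"
      by (simp add: q_def)
    ultimately show "norm (prob (E n)) \<le> (q n)\<^sup>2 + (q (n + d))\<^sup>2"
      unfolding prob_E by simp
  qed
  then have "AE \<omega> in M. \<forall>\<^sub>F n in sequentially. \<omega> \<in> space M - E n"
    by (intro borel_cantelli_AE1 E) (auto simp: less_top[symmetric])
  then show ?thesis
    by (rule AE_mp) (auto simp: E_def intro!: AE_I2 elim: eventually_mono)
qed

theorem proposition1p2:
  fixes M :: "'a measure" and X :: "nat \<Rightarrow> 'a \<Rightarrow> real" and p :: "nat \<Rightarrow> real"
  assumes "prob_space M"
    and "prob_space.indep_vars M (\<lambda>_. borel) X {1..}"
    and "\<And>k. k \<ge> 1 \<Longrightarrow> p k \<in> {0..1}"
    and "\<And>k. k \<ge> 1 \<Longrightarrow> \<P>(\<omega> in M. X k \<omega> = 1) = p k"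
    and "\<And>k. k \<ge> 1 \<Longrightarrow> 1 - \<P>(\<omega> in M. X k \<omega> = 0) = p k"
    and "\<not> summable (\<lambda>k. p (Suc k))"
    and "summable (\<lambda>k. (p (Suc k))\<^sup>2)"
  shows "AE \<omega> in M. infinite (success_set X \<omega>) \<and>
           \<not> bounded_gap (success_set X \<omega>) \<and>
           filterlim (\<lambda>k. real (enumerate (success_set X \<omega>) (Suc k)) - real (enumerate (success_set X \<omega>) k))
             at_top sequentially"
proof -
  interpret prob_space M by fact
  \<comment> \<open>Indices are shifted down by one, since the variables count only from index \<open>1\<close> on.\<close>
  define Y where "Y n = X (Suc n)" for n
  have indep: "indep_vars (\<lambda>_. borel) Y UNIV"
    unfolding Y_def[abs_def] by (rule indep_vars_reindex[OF assms(2)]) auto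
  have prob_Y: "\<P>(\<omega> in M. Y n \<omega> \<in> {1}) = p (Suc n)" for n
    using assms(4)[of "Suc n"] by (simp add: Y_def)
  have S_iff: "Suc n \<in> success_set X \<omega> \<longleftrightarrow> Y n \<omega> \<in> {1}" for n \<omega>
    by (simp add: success_set_def Y_def)
  have "AE \<omega> in M. infinite {n. Y n \<omega> \<in> {1}}"
    by (rule AE_infinite_indep_vars[OF indep]) (use assms(6) in \<open>simp_all only: prob_Y, auto\<close>)
  moreover have "AE \<omega> in M. \<forall>d. d \<ge> 1 \<longrightarrow>
      (\<forall>\<^sub>F n in sequentially. \<not> (Y n \<omega> \<in> {1} \<and> Y (n + d) \<omega> \<in> {1}))"
  proof (subst AE_all_countable, intro allI)
    fix d :: nat
    show "AE \<omega> in M. d \<ge> 1 \<longrightarrow>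
        (\<forall>\<^sub>F n in sequentially. \<not> (Y n \<omega> \<in> {1} \<and> Y (n + d) \<omega> \<in> {1}))"
    proof (cases "d \<ge> 1")
      case True
      have "AE \<omega> in M. \<forall>\<^sub>F n in sequentially. \<not> (Y n \<omega> \<in> {1} \<and> Y (n + d) \<omega> \<in> {1})"
        using assms(7) True
        by (intro AE_eventually_not_both_successes[OF indep]) (simp_all only: prob_Y, auto)
      then show ?thesis by simp
    qed simp
  qed
  ultimately show ?thesis
  proof eventually_elim
    case (elim \<omega>)
    let ?S = "success_set X \<omega>"
    have "Suc ` {n. Y n \<omega> \<in> {1}} \<subseteq> ?S"
      by (auto simp: S_iff simp del: singleton_iff)
    then have inf: "infinite ?S"
      using elim(1) by (meson finite_imageD finite_subset inj_Suc inj_on_subset subset_UNIV)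
    moreover have gaps: "filterlim (\<lambda>k. real (enumerate ?S (Suc k)) - real (enumerate ?S k))
        at_top sequentially"
    proof (rule filterlim_enumerate_gaps[OF inf])
      fix d :: nat
      assume "d \<ge> 1"
      then have "\<forall>\<^sub>F n in sequentially. \<not> (Suc n \<in> ?S \<and> Suc n + d \<in> ?S)"
        using elim(2) by (simp add: S_iff del: singleton_iff)
      then show "\<forall>\<^sub>F n in sequentially. \<not> (n \<in> ?S \<and> n + d \<in> ?S)"
        by (subst (asm) eventually_sequentially_Suc)
    qed
    ultimately show ?case
      using not_bounded_gap_if_gaps_at_top by blast
  qed
qed

end
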